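(* Let $\{a_n\}_{n=0}^\infty$ be a fixed sequence of real numbers with $a_n\in(-1,1)$ for every $n$. For $k\ge 0$ let $$R_k=\sum_{n=k}^\infty a_n^2,$$ and assume $$\sum_{n\ge 2}\frac{\sqrt{R_n}}{n\sqrt{\log n}}<\infty .$$ Let $\{\omega_n\}_{n=0}^\infty$ be a sequence of independent complex-valued random variables, each bounded by $1$ in absolute value and each with a rotationally symmetric distribution in $\mathbb{C}$. Let $\alpha_n=a_n\omega_n$, and let $\{\Phi_n^*\}_{n\ge0}$ be the (random) reversed monic orthogonal polynomials on the unit circle with Verblunsky parameters $\{\alpha_n\}$. Then with probability $1$ there exists a (random) finite constant $C$ such that $$\sup_{n}\|\Phi_n^*\|_\infty\le C .$$
   Context: $\mathbb{D}=\{z\in\mathbb{C}:|z|<1\}$ and $\mathbb{T}=\{z\in\mathbb{C}:|z|=1\}$. Given Verblunsky parameters $\{\alpha_n\}_{n=0}^\infty\in\mathbb{D}^\infty$, the monic orthogonal polynomials $\Phi_n$ and the reversed polynomials $\Phi_n^*$ are defined by $\Phi_0=\Phi_0^*=1$ and the Szegő recursion $$\Phi_{n+1}(z)=z\Phi_n(z)-\overline{\alpha_n}\,\Phi_n^*(z),\qquad \Phi_{n+1}^*(z)=\Phi_n^*(z)-\alpha_n z\Phi_n(z).$$ For $z\in\mathbb{T}$ one has $\Phi_n^*(z)=z^n\overline{\Phi_n(z)}$. (Equivalently, $\Phi_n$ are the monic orthogonal polynomials of the probability measure on $\mathbb{T}$ with infinite support that corresponds to $\{\alpha_n\}$ by Verblunsky's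 theorem.) $\|\cdot\|_\infty$ denotes the supremum norm on $\mathbb{T}$. A complex random variable $\omega$ is rotationally symmetric if $e^{it}\omega$ has the same law as $\omega$ for every real $t$. *)

theory Defs
  imports "HOL-Probability.Probability" "HOL-Computational_Algebra.Polynomial"
begin

text \<open>
  Monic orthogonal polynomials on the unit circle and their reversals, generated from the
  Verblunsky parameters by the Szego recursion.  The recursion makes sense for arbitrary complex
  parameters; the orthogonality interpretation needs them in the open unit disk.
\<close>

fun opuc :: "(nat \<Rightarrow> complex) \<Rightarrow> nat \<Rightarrow> complex poly"
  and opuc_rev :: "(nat \<Rightarrow> complex) \<Rightarrow> nat \<Rightarrow> complex poly"
where
  "opuc \<alpha> 0 = 1"
| "opuc \<alpha> (Suc n) = [:0, 1:] * opuc \<alpha> n - smult (cnj (\<alpha> n)) (opuc_rev \<alpha> n)"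
| "opuc_rev \<alpha> 0 = 1"
| "opuc_rev \<alpha> (Suc n) = opuc_rev \<alpha> n - smult (\<alpha> n) ([:0, 1:] * opuc \<alpha> n)"

text \<open>Being a supremum in the reals, this is meaningful only for \<open>f\<close> bounded on the circle.\<close>

definition circle_sup_norm :: "(complex \<Rightarrow> complex) \<Rightarrow> real" where
  "circle_sup_norm f = (SUP z\<in>sphere 0 1. norm (f z))"

definition rotationally_symmetric :: "'w measure \<Rightarrow> ('w \<Rightarrow> complex) \<Rightarrow> bool" where
  "rotationally_symmetric M X \<longleftrightarrow>
     (\<forall>t::real. distr M borel (\<lambda>w. exp (\<i> * of_real t) * X w) = distr M borel X)"

end

theory Submission
  imports Defs "HOL-Complex_Analysis.Cauchy_Integral_Formula"
begin

text \<open>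
  Write \<open>N\<^sub>k = 2\<^bsup>2^k\<^esup>\<close>. The growth of \<open>\<Phi>\<^sub>n\<^sup>*\<close> between the degrees \<open>N\<^sub>k\<close> and \<open>N\<^sub>k\<^sub>+\<^sub>1\<close> is
  controlled block by block, and the hypothesis on \<open>R\<close> is what makes the logarithms of the growth
  factors of the blocks summable.

  At a fixed point \<open>z\<close> of the circle the recursion reads
  \<open>\<Phi>\<^sub>n\<^sub>+\<^sub>1\<^sup>*(z) = \<Phi>\<^sub>n\<^sup>*(z) (1 - \<alpha>\<^sub>n u\<^sub>n)\<close>, where \<open>u\<^sub>n\<close> is unimodular and depends only on
  \<open>\<alpha>\<^sub>0, \<dots>, \<alpha>\<^sub>n\<^sub>-\<^sub>1\<close> (\<open>opuc_rev_Suc_on_circle\<close>). Rotational symmetry makes the powers of \<open>\<omega>\<^sub>n\<close>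
  orthogonal, so for every natural \<open>q\<close> and unimodular \<open>u\<close>, with \<open>C(q, k)\<close> the binomial coefficients,
  \<open>E |1 - a\<^sub>n \<omega>\<^sub>n u|\<^bsup>2q\<^esup> = \<Sum>\<^sub>k C(q, k)\<^sup>2 a\<^sub>n\<^bsup>2k\<^esup> E |\<omega>\<^sub>n|\<^bsup>2k\<^esup> \<le> exp (q\<^sup>2 a\<^sub>n\<^sup>2)\<close>
  (\<open>rotationally_symmetric_even_moment_le\<close>). Independence multiplies these bounds, so
  \<open>E |\<Phi>\<^sub>n\<^sup>*(z) / \<Phi>\<^sub>m\<^sup>*(z)|\<^bsup>2q\<^esup> \<le> exp (q\<^sup>2 R\<^sub>m)\<close> for \<open>m \<le> n\<close> (\<open>moment_ratio_le\<close>): the logarithm of the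
  ratio has Gaussian upper tails of variance of order \<open>R\<^sub>m\<close>.

  A polynomial of degree at most \<open>N\<close> is controlled by its values at the \<open>N\<^sup>5\<close>-th roots of unity up to
  a factor \<open>exp (1/N)\<close> (\<open>circle_sup_norm_le_roots_of_unity\<close>). With \<open>N = N\<^sub>k\<^sub>+\<^sub>1\<close>, a block thus involves at most
  \<open>N\<^sup>6\<close> pairs of a degree and a point. Since \<open>log N\<close> is of order \<open>2\<^sup>k\<close>, a union bound shows that
  the logarithm of the growth over the block exceeds a fixed multiple of
  \<open>sqrt (2\<^sup>k R\<^bsub>N_k\<^esub>) + 2\<^bsup>-k\<^esup>\<close> with summable probability only. By the Borel-Cantelli lemma this happens for finitely many blocks, almost
  surely. Two applications of Cauchy condensation turn the hypothesis into the convergence of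
  \<open>\<Sum>\<^sub>k sqrt (2\<^sup>k R\<^bsub>N_k\<^esub>)\<close> (\<open>condensed_tail_summable\<close>), so the product of all growth factors
  is finite.
\<close>

section \<open>The Szego recursion on the unit circle\<close>

lemma circle_opuc_eq:
  assumes "norm z = 1"
  shows "poly (opuc \<alpha> n) z = z ^ n * cnj (poly (opuc_rev \<alpha> n) z)"
proof (induction n)
  case (Suc n)
  have z: "z * cnj z = 1"
    using assms by (simp add: complex_norm_square [symmetric])
  have "z ^ n * cnj z ^ n = 1"
    by (metis power_mult_distrib power_one z)
  then have "poly (opuc_rev \<alpha> n) z = z ^ n * cnj (poly (opuc \<alpha> n) z)"
    by (simp add: Suc mult.assoc [symmetric])
  then have "z ^ Suc n * cnj (poly (opuc_rev \<alpha> (Suc n)) z)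
      = z * (z ^ n * cnj (poly (opuc_rev \<alpha> n) z)) - cnj (\<alpha> n) * (z * cnj z) * poly (opuc_rev \<alpha> n) z"
    by (simp add: algebra_simps)
  then show ?case
    by (simp add: z Suc)
qed simp

text \<open>
  On the circle \<open>z \<Phi>\<^sub>n(z)\<close> and \<open>\<Phi>\<^sub>n\<^sup>*(z)\<close> have the same modulus; the phase is their quotient. The value 1 at
  a zero of \<open>\<Phi>\<^sub>n\<^sup>*\<close> keeps the phase unimodular everywhere, and the multiplicative form of the
  recursion survives because both sides then vanish.
\<close>

definition szego_phase :: "complex \<Rightarrow> (nat \<Rightarrow> complex) \<Rightarrow> nat \<Rightarrow> complex" where
  "szego_phase z \<alpha> n =
    (let p = poly (opuc_rev \<alpha> n) z in if p = 0 then 1 else z ^ Suc n * cnj p / p)"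

lemma norm_szego_phase: "norm z = 1 \<Longrightarrow> norm (szego_phase z \<alpha> n) = 1"
  by (simp add: szego_phase_def Let_def norm_mult norm_divide norm_power)

lemma opuc_rev_Suc_on_circle:
  assumes "norm z = 1"
  shows "poly (opuc_rev \<alpha> (Suc n)) z
    = poly (opuc_rev \<alpha> n) z * (1 - \<alpha> n * szego_phase z \<alpha> n)"
  by (simp add: circle_opuc_eq [OF assms] szego_phase_def Let_def algebra_simps)

lemma opuc_cong:
  "(\<And>k. k < n \<Longrightarrow> \<alpha> k = \<beta> k) \<Longrightarrow> opuc \<alpha> n = opuc \<beta> n \<and> opuc_rev \<alpha> n = opuc_rev \<beta> n"
  by (induction n) simp_all

lemma degree_opuc: "degree (opuc \<alpha> n) \<le> n \<and> degree (opuc_rev \<alpha> n) \<le> n"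
proof (induction n)
  case (Suc n)
  have *: "degree ([:0, 1:] * opuc \<alpha> n) \<le> Suc n"
    using degree_mult_le [of "[:0, 1:]" "opuc \<alpha> n"] Suc by auto
  have "degree (smult c (opuc_rev \<alpha> n)) \<le> Suc n" for c
    using Suc degree_smult_le [of c "opuc_rev \<alpha> n"] by linarith
  moreover have "degree (smult c ([:0, 1:] * opuc \<alpha> n)) \<le> Suc n" for c
    using * degree_smult_le le_trans by blast
  ultimately show ?case
    using Suc * by (auto intro!: degree_diff_le simp del: mult_pCons_left smult_pCons)
qed simp

section \<open>Sup norms of polynomials on the circle\<close>

lemma bdd_above_circle: "bdd_above ((\<lambda>z. norm (poly p z)) ` sphere (0::complex) 1)"
  by (intro compact_imp_bounded bounded_imp_bdd_above compact_continuous_image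
      continuous_intros compact_sphere)

lemma norm_le_circle_sup_norm: "norm z = 1 \<Longrightarrow> norm (poly p z) \<le> circle_sup_norm (poly p)"
  using cSUP_upper [OF _ bdd_above_circle [of p], of z] by (simp add: circle_sup_norm_def)

lemma circle_sup_norm_le:
  "(\<And>z. norm z = 1 \<Longrightarrow> norm (f z) \<le> B) \<Longrightarrow> circle_sup_norm f \<le> B"
  unfolding circle_sup_norm_def by (rule cSUP_least) auto

lemma circle_sup_norm_nonneg: "0 \<le> circle_sup_norm (poly p)"
  using norm_le_circle_sup_norm [of 1 p] norm_ge_zero [of "poly p 1"] by (simp del: norm_ge_zero)

text \<open>Coefficients are Taylor coefficients at the origin, so Cauchy's inequality on the unit disc applies.\<close>

lemma norm_coeff_le_circle_sup_norm: "norm (coeff p k) \<le> circle_sup_norm (poly p)"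
proof -
  have "(deriv ^^ k) (poly p) = poly ((pderiv ^^ k) p)"
  proof (induction k)
    case (Suc k)
    have "deriv (poly q) = poly (pderiv q)" for q :: "complex poly"
      by (rule ext) (rule DERIV_imp_deriv [OF poly_DERIV])
    then show ?case
      by (simp add: Suc)
  qed simp
  moreover have "norm ((deriv ^^ k) (poly p) 0) \<le> fact k * circle_sup_norm (poly p) / 1 ^ k"
    by (rule Cauchy_inequality)
       (auto intro!: holomorphic_intros continuous_intros norm_le_circle_sup_norm)
  ultimately have "norm (fact k * coeff p k) \<le> fact k * circle_sup_norm (poly p)"
    by (simp add: poly_0_coeff_0 coeff_higher_pderiv pochhammer_fact)
  then show ?thesis
    by (simp add: norm_mult)
qed

text \<open>
  A crude substitute for Bernstein's inequality: the constant \<open>N\<^sup>2\<close> instead of \<open>N\<close> only increases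
  the number of sample points by a power of \<open>N\<close>, hence its logarithm by a constant factor.
\<close>

lemma poly_lipschitz_on_circle:
  assumes "degree p \<le> N" "norm z = 1" "norm w = 1"
  shows "norm (poly p z - poly p w) \<le> real N ^ 2 * norm (z - w) * circle_sup_norm (poly p)"
proof -
  let ?S = "circle_sup_norm (poly p)"
  have "poly p z - poly p w = (\<Sum>k\<in>{1..N}. coeff p k * (z ^ k - w ^ k))"
  proof -
    have "poly p x = (\<Sum>k\<le>N. coeff p k * x ^ k)" for x
      unfolding poly_altdef using assms(1)
      by (intro sum.mono_neutral_left) (auto simp: coeff_eq_0)
    then have "poly p z - poly p w = (\<Sum>k\<le>N. coeff p k * (z ^ k - w ^ k))"
      by (simp add: sum_subtractf algebra_simps)
    also have "\<dots> = (\<Sum>k\<in>{1..N}. coeff p k * (z ^ k - w ^ k))"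
      by (intro sum.mono_neutral_right) (auto simp: Suc_le_eq)
    finally show ?thesis .
  qed
  also have "norm \<dots> \<le> (\<Sum>k\<in>{1..N}. ?S * (real N * norm (z - w)))"
  proof (intro sum_norm_le)
    fix k assume k: "k \<in> {1..N}"
    have "norm (z ^ k - w ^ k) \<le> real k * norm (z - w)"
      using assms by (intro norm_power_diff) auto
    also have "\<dots> \<le> real N * norm (z - w)"
      using k by (intro mult_right_mono) auto
    finally show "norm (coeff p k * (z ^ k - w ^ k)) \<le> ?S * (real N * norm (z - w))"
      unfolding norm_mult
      by (intro mult_mono norm_coeff_le_circle_sup_norm circle_sup_norm_nonneg) auto
  qed
  also have "\<dots> = real N ^ 2 * norm (z - w) * ?S"
    by (simp add: power2_eq_square)
  finally show ?thesis .
qed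

lemma norm_cis_diff_le: "norm (cis t - cis s) \<le> \<bar>t - s\<bar>"
proof -
  have "cis t - cis s = cis s * (cis (t - s) - 1)"
    by (simp add: right_diff_distrib cis_mult)
  then have "norm (cis t - cis s) = 2 * \<bar>sin ((t - s) / 2)\<bar>"
    using dist_exp_i_1 [of "t - s"] by (simp add: norm_mult cis_conv_exp)
  also have "\<dots> \<le> 2 * \<bar>(t - s) / 2\<bar>"
    by (intro mult_left_mono abs_sin_x_le_abs_x) auto
  finally show ?thesis by simp
qed

lemma nearby_root_of_unity:
  assumes "norm z = 1" "0 < J"
  obtains j where "j < J" "norm (z - cis (2 * pi * real j / real J)) \<le> 8 / real J"
proof -
  define t where "t = Arg2pi z"
  have t: "0 \<le> t" "t < 2 * pi" "z = cis t"
    using Arg2pi [of z] assms by (auto simp: t_def cis_conv_exp is_Arg_def)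
  define j where "j = nat \<lfloor>t * real J / (2 * pi)\<rfloor>"
  have f: "real j \<le> t * real J / (2 * pi)" "t * real J / (2 * pi) < real j + 1"
    using t by (simp_all add: j_def)
  define s where "s = 2 * pi * real j / real J"
  have "s \<le> t" "t < s + 2 * pi / real J"
    using f \<open>0 < J\<close> by (simp_all add: s_def field_simps)
  then have "\<bar>t - s\<bar> \<le> 2 * pi / real J"
    by linarith
  also have "\<dots> \<le> 8 / real J"
    using pi_less_4 by (intro divide_right_mono) auto
  finally have "norm (cis t - cis s) \<le> 8 / real J"
    using norm_cis_diff_le [of t s] by linarith
  moreover have "t * real J < 2 * pi * real J"
    using t \<open>0 < J\<close> by simp
  then have "t * real J / (2 * pi) < real J"
    by (simp add: field_simps)
  with f have "real j < real J"
    by linarith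
  ultimately show ?thesis
    using that [of j] unfolding \<open>z = cis t\<close> s_def by simp
qed

text \<open>
  Every point of the circle is within \<open>8/N\<^sup>5\<close> of a sample point, so by the Lipschitz bound the two values
  of the polynomial differ by at most \<open>8/N\<^sup>3 \<le> 1/(2N)\<close> times the sup norm itself; at a maximum point
  this part is absorbed in the left-hand side.
  The exponential form of the factor makes the losses of successive blocks add up.
\<close>

lemma circle_sup_norm_le_roots_of_unity:
  assumes deg: "degree p \<le> N" and N: "4 \<le> N"
    and B: "\<And>j. j < N ^ 5 \<Longrightarrow> norm (poly p (cis (2 * pi * real j / real (N ^ 5)))) \<le> B"
  shows "circle_sup_norm (poly p) \<le> exp (1 / real N) * B"
proof -
  let ?S = "circle_sup_norm (poly p)"
  define x where "x = 1 / (2 * real N)"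
  have x: "0 < x" "x \<le> 1 / 2"
    using N by (auto simp: x_def field_simps)
  have mesh: "real N ^ 2 * (8 / real (N ^ 5)) \<le> x"
  proof -
    have "4 ^ 2 \<le> real N ^ 2"
      using N by (intro power_mono) auto
    then show ?thesis
      using N by (simp add: x_def field_simps eval_nat_numeral)
  qed
  have "?S \<le> B + x * ?S"
  proof (rule circle_sup_norm_le)
    fix z :: complex assume z: "norm z = 1"
    obtain j where j: "j < N ^ 5" "norm (z - cis (2 * pi * real j / real (N ^ 5))) \<le> 8 / real (N ^ 5)"
      using nearby_root_of_unity [OF z, of "N ^ 5"] N by auto
    let ?w = "cis (2 * pi * real j / real (N ^ 5))"
    have "norm (poly p z) \<le> norm (poly p ?w) + norm (poly p z - poly p ?w)"
      by (rule norm_triangle_sub)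
    also have "\<dots> \<le> B + real N ^ 2 * norm (z - ?w) * ?S"
      by (intro add_mono B j poly_lipschitz_on_circle deg z) simp
    also have "\<dots> \<le> B + real N ^ 2 * (8 / real (N ^ 5)) * ?S"
      by (intro add_left_mono mult_right_mono mult_left_mono j circle_sup_norm_nonneg) auto
    also have "\<dots> \<le> B + x * ?S"
      by (intro add_left_mono mult_right_mono mesh circle_sup_norm_nonneg)
    finally show "norm (poly p z) \<le> B + x * ?S" .
  qed
  then have *: "?S * (1 - x) \<le> B"
    by (simp add: algebra_simps)
  have "0 \<le> ?S * (1 - x)"
    using x by (intro mult_nonneg_nonneg circle_sup_norm_nonneg) auto
  with * have "0 \<le> B" by linarith
  have "x * (2 * x) \<le> x * 1"
    using x by (intro mult_left_mono) auto
  then have "?S * 1 \<le> ?S * ((1 - x) * (1 + 2 * x))"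
    by (intro mult_left_mono circle_sup_norm_nonneg) (simp add: algebra_simps)
  also have "\<dots> = ?S * (1 - x) * (1 + 2 * x)"
    by simp
  also have "\<dots> \<le> B * (1 + 2 * x)"
    using * x by (intro mult_right_mono) auto
  also have "\<dots> \<le> B * exp (2 * x)"
    using \<open>0 \<le> B\<close> by (intro mult_left_mono exp_ge_add_one_self) auto
  finally show ?thesis
    by (simp add: x_def mult.commute)
qed

section \<open>Even moments of a rotationally symmetric perturbation of 1\<close>

text \<open>
  Rotating \<open>X\<close> by \<open>t\<close> multiplies the moment by \<open>cis ((j - k) t)\<close> and leaves the law unchanged; for
  \<open>t = \<pi>/(j - k)\<close> the moment equals its own negative.
\<close>

lemma rotationally_symmetric_mixed_moment:
  assumes "X \<in> borel_measurable M" "rotationally_symmetric M X" "j \<noteq> k"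
  shows "(\<integral>w. X w ^ j * cnj (X w) ^ k \<partial>M) = 0"
proof -
  define t :: real where "t = pi / (real j - real k)"
  define I where "I = (\<integral>w. X w ^ j * cnj (X w) ^ k \<partial>M)"
  note [measurable] = assms(1)
  have m: "(\<lambda>x. x ^ j * cnj x ^ k) \<in> borel_measurable borel"
    by (intro borel_measurable_continuous_onI continuous_intros)
  have "I = (\<integral>x. x ^ j * cnj x ^ k \<partial>distr M borel X)"
    unfolding I_def by (subst integral_distr [OF _ m]) auto
  also have "\<dots> = (\<integral>x. x ^ j * cnj x ^ k \<partial>distr M borel (\<lambda>w. exp (\<i> * of_real t) * X w))"
    using assms(2) by (simp add: rotationally_symmetric_def)
  also have "\<dots> = (\<integral>w. (exp (\<i> * of_real t) * X w) ^ j * cnj (exp (\<i> * of_real t) * X w) ^ k \<partial>M)"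
    by (subst integral_distr [OF _ m]) auto
  also have "\<dots> = (\<integral>w. cis ((real j - real k) * t) * (X w ^ j * cnj (X w) ^ k) \<partial>M)"
  proof (rule Bochner_Integration.integral_cong [OF refl])
    fix w
    have "exp (\<i> * of_real t) ^ j * cnj (exp (\<i> * of_real t)) ^ k = cis ((real j - real k) * t)"
      by (simp only: cis_conv_exp [symmetric] cis_cnj Complex.DeMoivre cis_mult left_diff_distrib
          mult_minus_right add_uminus_conv_diff)
    then show "(exp (\<i> * of_real t) * X w) ^ j * cnj (exp (\<i> * of_real t) * X w) ^ k
        = cis ((real j - real k) * t) * (X w ^ j * cnj (X w) ^ k)"
      by (simp add: power_mult_distrib)
  qed
  also have "\<dots> = - I"
    using assms(3) by (simp add: t_def I_def cis_pi)
  finally show ?thesis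
    by (simp add: I_def)
qed

text \<open>
  Replacing one of the two binomial coefficients by \<open>q\<^sup>k\<close> leaves the binomial expansion of
  \<open>(1 + q a\<^sup>2)\<^sup>q\<close>.
\<close>

lemma sum_binomial_sq_le_exp:
  fixes a :: real
  shows "(\<Sum>k\<le>q. (real (q choose k) * a ^ k)\<^sup>2) \<le> exp (real q ^ 2 * a ^ 2)"
proof -
  have "q choose k \<le> q ^ k" for k
    by (cases "k \<le> q") (simp_all add: binomial_le_pow binomial_eq_0)
  then have "real (q choose k) \<le> real q ^ k" for k
    by (metis of_nat_le_iff of_nat_power)
  then have "(\<Sum>k\<le>q. (real (q choose k) * a ^ k)\<^sup>2)
      \<le> (\<Sum>k\<le>q. real (q choose k) * (real q * a\<^sup>2) ^ k)"
    by (intro sum_mono)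
       (simp add: power_mult_distrib power_mult [symmetric] mult.commute [of _ 2],
        simp add: power_mult power2_eq_square mult.assoc mult_left_mono mult_right_mono)
  also have "\<dots> = (1 + real q * a\<^sup>2) ^ q"
    by (subst add.commute, subst binomial_ring) simp
  also have "\<dots> \<le> exp (real q * a\<^sup>2) ^ q"
    by (intro power_mono exp_ge_add_one_self) auto
  also have "\<dots> = exp (real q ^ 2 * a ^ 2)"
    by (simp add: exp_of_nat_mult [symmetric] power2_eq_square mult_ac)
  finally show ?thesis .
qed

text \<open>
  Expand \<open>|1 - a X u|\<^bsup>2q\<^esup>\<close> as the product of \<open>(1 - a X u)\<^sup>q\<close> and its conjugate. Only the diagonal terms
  survive integration, and those contain no linear term in \<open>a\<close>: this is what makes the exponent
  quadratic in \<open>q a\<close>.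
\<close>

lemma (in prob_space) rotationally_symmetric_even_moment_le:
  fixes a :: real and u :: complex
  assumes [measurable]: "random_variable borel X"
    and rot: "rotationally_symmetric M X"
    and bd: "AE w in M. norm (X w) \<le> 1"
    and u: "norm u = 1"
  shows "(\<integral>\<^sup>+w. ennreal (norm (1 - of_real a * X w * u) ^ (2 * q)) \<partial>M)
    \<le> ennreal (exp (real q ^ 2 * a ^ 2))"
proof -
  define c :: "nat \<Rightarrow> complex" where "c k = of_nat (q choose k) * (- of_real a * u) ^ k" for k
  have [measurable]: "random_variable borel (\<lambda>w. cnj (X w))"
    by (intro borel_measurable_continuous_on [OF continuous_on_cnj [OF continuous_on_id]]) auto
  have int: "integrable M (\<lambda>w. X w ^ j * cnj (X w) ^ k)" for j k
    by (rule integrable_const_bound [where B = 1],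
        use bd in \<open>auto simp: norm_mult norm_power elim!: eventually_mono
          intro!: mult_le_one power_le_one\<close>) measurable
  have eq: "of_real (norm (1 - of_real a * X w * u) ^ (2 * q))
      = (\<Sum>j\<le>q. \<Sum>k\<le>q. c j * cnj (c k) * (X w ^ j * cnj (X w) ^ k))" for w
  proof -
    have "(1 - of_real a * X w * u) ^ q = (\<Sum>j\<le>q. c j * X w ^ j)"
    proof -
      have "(1 - of_real a * X w * u) ^ q = ((- of_real a * u) * X w + 1) ^ q"
        by (simp add: mult.commute mult.left_commute)
      also have "\<dots> = (\<Sum>j\<le>q. c j * X w ^ j)"
        unfolding binomial_ring c_def power_mult_distrib [of _ "X w"] by (simp add: mult_ac)
      finally show ?thesis .
    qed
    moreover have "of_real (norm y ^ (2 * q)) = y ^ q * cnj (y ^ q)" for y :: complex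
    proof -
      have "y ^ q * cnj (y ^ q) = of_real ((norm (y ^ q))\<^sup>2)"
        by (rule complex_norm_square [symmetric])
      then show ?thesis
        by (simp add: norm_power power_mult [symmetric] mult.commute [of q 2])
    qed
    ultimately have "of_real (norm (1 - of_real a * X w * u) ^ (2 * q))
        = (\<Sum>j\<le>q. c j * X w ^ j) * cnj (\<Sum>k\<le>q. c k * X w ^ k)"
      by (simp only:)
    also have "\<dots> = (\<Sum>j\<le>q. \<Sum>k\<le>q. (c j * X w ^ j) * (cnj (c k) * cnj (X w) ^ k))"
      by (simp add: sum_product)
    also have "\<dots> = (\<Sum>j\<le>q. \<Sum>k\<le>q. c j * cnj (c k) * (X w ^ j * cnj (X w) ^ k))"
      by (simp only: mult_ac)
    finally show ?thesis .
  qed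
  have int': "integrable M (\<lambda>w. complex_of_real (norm (1 - of_real a * X w * u) ^ (2 * q)))"
    unfolding eq by (intro Bochner_Integration.integrable_sum integrable_mult_right int)
  have diag: "norm (c j * cnj (c j) * (\<integral>w. X w ^ j * cnj (X w) ^ j \<partial>M)) \<le> (real (q choose j) * a ^ j)\<^sup>2" for j
  proof -
    have "norm (\<integral>w. X w ^ j * cnj (X w) ^ j \<partial>M) \<le> (\<integral>w. norm (X w ^ j * cnj (X w) ^ j) \<partial>M)"
      by (rule integral_norm_bound)
    also have "\<dots> \<le> (\<integral>w. 1 \<partial>M)"
      by (rule integral_mono_AE)
         (use bd integrable_norm [OF int, of j j] in \<open>auto simp: norm_mult norm_power elim!: eventually_mono
            intro!: mult_le_one power_le_one\<close>)
    finally have "norm (\<integral>w. X w ^ j * cnj (X w) ^ j \<partial>M) \<le> 1"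
      by (simp add: prob_space)
    moreover have "norm (c j * cnj (c j)) = (real (q choose j) * a ^ j)\<^sup>2"
    proof -
      have "norm (c j) = \<bar>real (q choose j) * a ^ j\<bar>"
        using u by (simp add: c_def norm_mult norm_power abs_mult power_abs)
      moreover have "norm (c j * cnj (c j)) = (norm (c j))\<^sup>2"
        by (simp add: norm_mult power2_eq_square)
      ultimately show ?thesis by simp
    qed
    ultimately show ?thesis
      unfolding norm_mult [of "c j * cnj (c j)"] by (simp add: mult_left_le)
  qed
  have "complex_of_real (\<integral>w. norm (1 - of_real a * X w * u) ^ (2 * q) \<partial>M)
      = (\<integral>w. (\<Sum>j\<le>q. \<Sum>k\<le>q. c j * cnj (c k) * (X w ^ j * cnj (X w) ^ k)) \<partial>M)"
    unfolding eq [symmetric] by (rule integral_complex_of_real [symmetric])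
  also have "\<dots> = (\<Sum>j\<le>q. \<Sum>k\<le>q. c j * cnj (c k) * (\<integral>w. X w ^ j * cnj (X w) ^ k \<partial>M))"
    using int by (simp add: Bochner_Integration.integral_sum)
  also have "\<dots> = (\<Sum>j\<le>q. c j * cnj (c j) * (\<integral>w. X w ^ j * cnj (X w) ^ j \<partial>M))"
  proof (rule sum.cong [OF refl])
    fix j assume "j \<in> {..q}"
    then show "(\<Sum>k\<le>q. c j * cnj (c k) * (\<integral>w. X w ^ j * cnj (X w) ^ k \<partial>M))
        = c j * cnj (c j) * (\<integral>w. X w ^ j * cnj (X w) ^ j \<partial>M)"
      by (subst sum.remove [of _ j])
         (simp_all add: rotationally_symmetric_mixed_moment [OF assms(1) rot])
  qed
  finally have "norm (complex_of_real (\<integral>w. norm (1 - of_real a * X w * u) ^ (2 * q) \<partial>M))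
      = norm (\<Sum>j\<le>q. c j * cnj (c j) * (\<integral>w. X w ^ j * cnj (X w) ^ j \<partial>M))"
    by (rule arg_cong)
  then have "(\<integral>w. norm (1 - of_real a * X w * u) ^ (2 * q) \<partial>M)
      \<le> norm (\<Sum>j\<le>q. c j * cnj (c j) * (\<integral>w. X w ^ j * cnj (X w) ^ j \<partial>M))"
    by (simp only: norm_of_real)
  also have "\<dots> \<le> (\<Sum>j\<le>q. (real (q choose j) * a ^ j)\<^sup>2)"
    by (intro sum_norm_le diag)
  also have "\<dots> \<le> exp (real q ^ 2 * a ^ 2)"
    by (rule sum_binomial_sq_le_exp)
  finally have "(\<integral>w. norm (1 - of_real a * X w * u) ^ (2 * q) \<partial>M) \<le> exp (real q ^ 2 * a ^ 2)" .
  moreover have "integrable M (\<lambda>w. norm (1 - of_real a * X w * u) ^ (2 * q))"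
    using int' unfolding complex_of_real_integrable_eq .
  ultimately show ?thesis
    by (subst nn_integral_eq_integral) (auto intro: ennreal_leI)
qed

section \<open>Growth of the reversed polynomials at a point\<close>

text \<open>
  The polynomials up to degree \<open>n\<close> are measurable functions of the first \<open>n\<close> parameters. This is
  what allows Fubini's theorem to separate the past from the next parameter.
\<close>

lemma opuc_rev_measurable:
  assumes "m \<le> n"
  shows "(\<lambda>x. poly (opuc (\<lambda>k. of_real (a k) * x k) m) z) \<in> borel_measurable (PiM {..<n} (\<lambda>_. borel)) \<and>
    (\<lambda>x. poly (opuc_rev (\<lambda>k. of_real (a k) * x k) m) z) \<in> borel_measurable (PiM {..<n} (\<lambda>_. borel))"
  using assms
proof (induction m)
  case (Suc m)
  then have [measurable]: "(\<lambda>x. poly (opuc (\<lambda>k. of_real (a k) * x k) m) z) \<in> borel_measurable (PiM {..<n} (\<lambda>_. borel))"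
    "(\<lambda>x. poly (opuc_rev (\<lambda>k. of_real (a k) * x k) m) z) \<in> borel_measurable (PiM {..<n} (\<lambda>_. borel))"
    "(\<lambda>x. x m) \<in> borel_measurable (PiM {..<n} (\<lambda>_. borel :: complex measure))"
    using measurable_component_singleton [of m "{..<n}" "\<lambda>_. borel :: complex measure"] by auto
  have [measurable]: "(\<lambda>x. cnj (x m)) \<in> borel_measurable (PiM {..<n} (\<lambda>_. borel :: complex measure))"
    by (intro borel_measurable_continuous_on [OF continuous_on_cnj [OF continuous_on_id]]) auto
  show ?case by simp
qed simp

text \<open>
  Conditionally on the past, the phase \<open>u\<close> is a constant of modulus 1 and \<open>\<omega>\<^sub>n\<close> retains its law, so the
  moment bound for a fixed phase applies under the integral over the past.
\<close>

lemma (in prob_space) nn_integral_past_times_step_le: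
  fixes \<omega> :: "nat \<Rightarrow> 'a \<Rightarrow> complex" and a :: real
  assumes ind: "indep_vars (\<lambda>_. borel) \<omega> UNIV"
    and bd: "AE w in M. norm (\<omega> n w) \<le> 1"
    and rot: "rotationally_symmetric M (\<omega> n)"
    and [measurable]: "g \<in> borel_measurable (PiM {..<n} (\<lambda>_. borel))"
    and [measurable]: "u \<in> borel_measurable (PiM {..<n} (\<lambda>_. borel))"
    and u: "\<And>x. norm (u x) = 1"
  shows "(\<integral>\<^sup>+w. g (\<lambda>i\<in>{..<n}. \<omega> i w) *
            ennreal (norm (1 - of_real a * \<omega> n w * u (\<lambda>i\<in>{..<n}. \<omega> i w)) ^ (2 * q)) \<partial>M)
    \<le> ennreal (exp (real q ^ 2 * a ^ 2)) * (\<integral>\<^sup>+w. g (\<lambda>i\<in>{..<n}. \<omega> i w) \<partial>M)"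
proof -
  let ?S = "PiM {..<n} (\<lambda>_. borel :: complex measure)"
  let ?T = "PiM {n} (\<lambda>_. borel :: complex measure)"
  let ?P = "\<lambda>w. \<lambda>i\<in>{..<n}. \<omega> i w"
  let ?Q = "\<lambda>w. \<lambda>i\<in>{n}. \<omega> i w"
  let ?f = "\<lambda>x y. ennreal (norm (1 - of_real a * y * u x) ^ (2 * q))"
  have [measurable]: "random_variable borel (\<omega> i)" for i
    using ind by (simp add: indep_vars_def)
  have ind': "indep_var ?S ?P ?T ?Q"
    using ind by (rule indep_var_restrict) auto
  then have *: "distr M ?S ?P \<Otimes>\<^sub>M distr M ?T ?Q = distr M (?S \<Otimes>\<^sub>M ?T) (\<lambda>w. (?P w, ?Q w))"
    unfolding indep_var_distribution_eq by blast
  have [measurable]: "?P \<in> measurable M ?S" "?Q \<in> measurable M ?T"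
    using indep_var_rv1 [OF ind'] indep_var_rv2 [OF ind'] by auto
  have [measurable]: "(\<lambda>f. f n) \<in> borel_measurable ?T"
    using measurable_component_singleton [of n "{n}" "\<lambda>_. borel :: complex measure"] by auto
  interpret N: prob_space "distr M ?T ?Q"
    by (rule prob_space_distr) simp
  have "(\<integral>\<^sup>+w. g (?P w) * ?f (?P w) (\<omega> n w) \<partial>M)
      = (\<integral>\<^sup>+p. g (fst p) * ?f (fst p) (snd p n) \<partial>(distr M ?S ?P \<Otimes>\<^sub>M distr M ?T ?Q))"
    unfolding * by (subst nn_integral_distr) auto
  also have "\<dots> = (\<integral>\<^sup>+x. \<integral>\<^sup>+y. g x * ?f x (y n) \<partial>distr M ?T ?Q \<partial>distr M ?S ?P)"
    by (subst N.nn_integral_fst [symmetric]) auto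
  also have "\<dots> = (\<integral>\<^sup>+x. g x * (\<integral>\<^sup>+w. ?f x (\<omega> n w) \<partial>M) \<partial>distr M ?S ?P)"
    by (simp add: nn_integral_cmult nn_integral_distr)
  also have "\<dots> \<le> (\<integral>\<^sup>+x. g x * ennreal (exp (real q ^ 2 * a ^ 2)) \<partial>distr M ?S ?P)"
    by (intro nn_integral_mono mult_left_mono rotationally_symmetric_even_moment_le rot bd u) auto
  also have "\<dots> = ennreal (exp (real q ^ 2 * a ^ 2)) * (\<integral>\<^sup>+w. g (?P w) \<partial>M)"
    by (simp add: nn_integral_multc nn_integral_distr mult.commute)
  finally show ?thesis .
qed

locale random_verblunsky = prob_space M for M :: "'w measure" +
  fixes \<omega> :: "nat \<Rightarrow> 'w \<Rightarrow> complex" and a :: "nat \<Rightarrow> real"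
  assumes indep: "indep_vars (\<lambda>_. borel) \<omega> UNIV"
    and bounded: "AE w in M. norm (\<omega> n w) \<le> 1"
    and rotation: "rotationally_symmetric M (\<omega> n)"
begin

definition rev_poly :: "nat \<Rightarrow> 'w \<Rightarrow> complex poly" where
  "rev_poly n w = opuc_rev (\<lambda>k. of_real (a k) * \<omega> k w) n"

lemma rev_poly_eq_past:
  assumes "m \<le> n"
  shows "opuc_rev (\<lambda>k. of_real (a k) * (\<lambda>i\<in>{..<n}. \<omega> i w) k) m = rev_poly m w"
  unfolding rev_poly_def
  by (rule opuc_cong [THEN conjunct2]) (use assms in auto)

lemma past_measurable: "(\<lambda>w. \<lambda>i\<in>{..<n}. \<omega> i w) \<in> measurable M (PiM {..<n} (\<lambda>_. borel))"
  using indep by (intro measurable_restrict) (simp add: indep_vars_def)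

lemma rev_poly_measurable [measurable]: "(\<lambda>w. poly (rev_poly n w) z) \<in> borel_measurable M"
  using measurable_compose [OF past_measurable opuc_rev_measurable [OF order_refl, THEN conjunct2, of a n z]]
  by (simp only: rev_poly_eq_past [OF order_refl])

text \<open>
  Each further degree multiplies the ratio by one factor whose moment is bounded conditionally on the
  past, so the bounds multiply. The convention \<open>x / 0 = 0\<close> is harmless here: on the circle a zero of \<open>\<Phi>\<^sub>m\<^sup>*\<close> is inherited by all later
  \<open>\<Phi>\<^sub>n\<^sup>*\<close>.
\<close>

lemma moment_ratio_le:
  assumes z: "norm z = 1" and "m \<le> n"
  shows "(\<integral>\<^sup>+w. ennreal ((norm (poly (rev_poly n w) z) / norm (poly (rev_poly m w) z)) ^ (2 * q)) \<partial>M)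
    \<le> ennreal (exp (real q ^ 2 * (\<Sum>j\<in>{m..<n}. (a j)\<^sup>2)))"
  using \<open>m \<le> n\<close>
proof (induction n rule: dec_induct)
  case base
  have "(\<integral>\<^sup>+w. ennreal ((norm (poly (rev_poly m w) z) / norm (poly (rev_poly m w) z)) ^ (2 * q)) \<partial>M)
      \<le> (\<integral>\<^sup>+w. 1 \<partial>M)"
    by (intro nn_integral_mono) (auto simp: divide_self_if power_0_left)
  then show ?case by (simp add: emeasure_space_1)
next
  case (step n)
  let ?\<alpha> = "\<lambda>x k. of_real (a k) * x k :: complex"
  let ?past = "\<lambda>w. \<lambda>i\<in>{..<n}. \<omega> i w"
  define u where "u x = szego_phase z (?\<alpha> x) n" for x
  define g where "g x = ennreal ((norm (poly (opuc_rev (?\<alpha> x) n) z)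
      / norm (poly (opuc_rev (?\<alpha> x) m) z)) ^ (2 * q))" for x
  note [measurable] = opuc_rev_measurable [OF order_refl, THEN conjunct2, of a n z]
    opuc_rev_measurable [OF \<open>m \<le> n\<close>, THEN conjunct2, of a z]
  have [measurable]: "(\<lambda>x. cnj (poly (opuc_rev (?\<alpha> x) n) z)) \<in> borel_measurable (PiM {..<n} (\<lambda>_. borel))"
    by (intro borel_measurable_continuous_on [OF continuous_on_cnj [OF continuous_on_id]]) auto
  have g_meas: "g \<in> borel_measurable (PiM {..<n} (\<lambda>_. borel))"
    unfolding g_def by measurable
  have u_meas: "u \<in> borel_measurable (PiM {..<n} (\<lambda>_. borel))"
    unfolding u_def szego_phase_def Let_def by measurable
  have g_past: "g (?past w) = ennreal ((norm (poly (rev_poly n w) z) / norm (poly (rev_poly m w) z)) ^ (2 * q))" for w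
    using \<open>m \<le> n\<close> by (simp only: g_def rev_poly_eq_past order_refl)
  have u_past: "u (?past w) = szego_phase z (\<lambda>k. of_real (a k) * \<omega> k w) n" for w
    unfolding u_def szego_phase_def rev_poly_eq_past [OF order_refl] by (simp add: rev_poly_def)
  have "(norm (poly (rev_poly (Suc n) w) z) / norm (poly (rev_poly m w) z)) ^ (2 * q)
      = (norm (poly (rev_poly n w) z) / norm (poly (rev_poly m w) z)) ^ (2 * q)
        * norm (1 - of_real (a n) * \<omega> n w * u (?past w)) ^ (2 * q)" for w
    unfolding u_past rev_poly_def opuc_rev_Suc_on_circle [OF z]
    by (simp only: norm_mult power_mult_distrib [symmetric] times_divide_eq_left)
  then have "(\<integral>\<^sup>+w. ennreal ((norm (poly (rev_poly (Suc n) w) z) / norm (poly (rev_poly m w) z)) ^ (2 * q)) \<partial>M)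
      = (\<integral>\<^sup>+w. g (?past w) * ennreal (norm (1 - of_real (a n) * \<omega> n w * u (?past w)) ^ (2 * q)) \<partial>M)"
    unfolding g_past by (simp only: ennreal_mult' zero_le_power divide_nonneg_nonneg norm_ge_zero)
  also have "\<dots> \<le> ennreal (exp (real q ^ 2 * (a n)\<^sup>2)) * (\<integral>\<^sup>+w. g (?past w) \<partial>M)"
    by (rule nn_integral_past_times_step_le [OF indep bounded rotation g_meas u_meas])
       (simp add: u_def norm_szego_phase z)
  also have "\<dots> \<le> ennreal (exp (real q ^ 2 * (a n)\<^sup>2))
      * ennreal (exp (real q ^ 2 * (\<Sum>j\<in>{m..<n}. (a j)\<^sup>2)))"
    unfolding g_past by (intro mult_left_mono step.IH) auto
  also have "\<dots> = ennreal (exp (real q ^ 2 * (\<Sum>j\<in>{m..<Suc n}. (a j)\<^sup>2)))"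
    using \<open>m \<le> n\<close> by (simp add: ennreal_mult' [symmetric] exp_add [symmetric] algebra_simps)
  finally show ?case .
qed

text \<open>Markov's inequality for the moment of order \<open>2q\<close>; the order is left free, to be optimised later.\<close>

lemma prob_growth_le:
  assumes z: "norm z = 1" and mn: "m \<le> n" and r: "(\<Sum>j\<in>{m..<n}. (a j)\<^sup>2) \<le> r"
  shows "prob {w \<in> space M. exp \<eta> * norm (poly (rev_poly m w) z) < norm (poly (rev_poly n w) z)}
    \<le> exp (real q ^ 2 * r - 2 * real q * \<eta>)" (is "prob ?E \<le> _")
proof -
  let ?u = "\<lambda>w. (norm (poly (rev_poly n w) z) / norm (poly (rev_poly m w) z)) ^ (2 * q)"
  let ?c = "exp (- (2 * real q * \<eta>))"
  have sub: "?E \<subseteq> {w \<in> space M. 1 \<le> ennreal ?c * ennreal (?u w)}"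
  proof safe
    fix w assume "exp \<eta> * norm (poly (rev_poly m w) z) < norm (poly (rev_poly n w) z)"
    moreover have "poly (rev_poly n w) z = 0" if "poly (rev_poly m w) z = 0"
      using mn that
      by (induction rule: dec_induct) (simp_all add: rev_poly_def opuc_rev_Suc_on_circle [OF z] del: opuc_rev.simps)
    ultimately have "exp \<eta> < norm (poly (rev_poly n w) z) / norm (poly (rev_poly m w) z)"
      by (cases "poly (rev_poly m w) z = 0") (auto simp: pos_less_divide_eq)
    then have "exp \<eta> ^ (2 * q) \<le> ?u w"
      by (intro power_mono) auto
    then have "?c * exp \<eta> ^ (2 * q) \<le> ?c * ?u w"
      by (intro mult_left_mono) auto
    moreover have "?c * exp \<eta> ^ (2 * q) = 1"
      by (simp add: exp_of_nat_mult [symmetric] exp_add [symmetric] mult_ac)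
    ultimately show "1 \<le> ennreal ?c * ennreal (?u w)"
      by (simp add: ennreal_mult' [symmetric])
  qed
  have "emeasure M ?E \<le> emeasure M {w \<in> space M. 1 \<le> ennreal ?c * ennreal (?u w)}"
    by (intro emeasure_mono sub) measurable
  also have "\<dots> \<le> ennreal ?c * (\<integral>\<^sup>+w. ennreal (?u w) * indicator (space M) w \<partial>M)"
    by (rule nn_integral_Markov_inequality) auto
  also have "(\<integral>\<^sup>+w. ennreal (?u w) * indicator (space M) w \<partial>M) = (\<integral>\<^sup>+w. ennreal (?u w) \<partial>M)"
    by (intro nn_integral_cong) simp
  also have "ennreal ?c * \<dots> \<le> ennreal ?c * ennreal (exp (real q ^ 2 * r))"
    using r by (intro mult_left_mono order_trans [OF moment_ratio_le [OF z mn]])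
      (auto intro!: ennreal_leI mult_left_mono)
  also have "\<dots> = ennreal (exp (real q ^ 2 * r - 2 * real q * \<eta>))"
    by (simp add: ennreal_mult' [symmetric] exp_add [symmetric])
  finally show ?thesis
    by (simp add: emeasure_eq_measure)
qed

section \<open>Growth of the sup norm over a block\<close>

text \<open>
  The sample points are the \<open>N\<^sup>5\<close>-th roots of unity, dense enough for all degrees up to \<open>N\<close>.
\<close>

definition growth_event :: "nat \<Rightarrow> nat \<Rightarrow> real \<Rightarrow> 'w set" where
  "growth_event m N \<eta> = (\<Union>n\<in>{m<..N}. \<Union>j<N ^ 5. {w \<in> space M.
     exp \<eta> * norm (poly (rev_poly m w) (cis (2 * pi * real j / real (N ^ 5))))
       < norm (poly (rev_poly n w) (cis (2 * pi * real j / real (N ^ 5))))})"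

lemma growth_event_sets [measurable]: "growth_event m N \<eta> \<in> events"
  unfolding growth_event_def by measurable

lemma prob_growth_event_le:
  assumes "\<And>n. (\<Sum>j\<in>{m..<n}. (a j)\<^sup>2) \<le> r"
  shows "prob (growth_event m N \<eta>) \<le> real N ^ 6 * exp (real q ^ 2 * r - 2 * real q * \<eta>)"
proof -
  let ?p = "exp (real q ^ 2 * r - 2 * real q * \<eta>)"
  have "prob (growth_event m N \<eta>) \<le> (\<Sum>n\<in>{m<..N}. \<Sum>j<N ^ 5. ?p)"
    unfolding growth_event_def
    by (intro order_trans [OF measure_UNION_le] sum_mono prob_growth_le assms) auto
  also have "\<dots> = real (N - m) * (real N ^ 5 * ?p)"
    by simp
  also have "\<dots> \<le> real N * (real N ^ 5 * ?p)"
    by (intro mult_right_mono) auto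
  finally show ?thesis by (simp add: eval_nat_numeral mult_ac)
qed

lemma circle_sup_norm_outside_growth_event:
  assumes w: "w \<in> space M - growth_event m N \<eta>" and n: "n \<in> {m<..N}" and "4 \<le> N"
  shows "circle_sup_norm (poly (rev_poly n w))
    \<le> exp (\<eta> + 1 / real N) * circle_sup_norm (poly (rev_poly m w))"
proof -
  have "circle_sup_norm (poly (rev_poly n w))
      \<le> exp (1 / real N) * (exp \<eta> * circle_sup_norm (poly (rev_poly m w)))"
  proof (rule circle_sup_norm_le_roots_of_unity)
    show "degree (rev_poly n w) \<le> N"
      using degree_opuc n unfolding rev_poly_def by (meson greaterThanAtMost_iff le_trans)
    fix j assume j: "j < N ^ 5"
    let ?z = "cis (2 * pi * real j / real (N ^ 5))"
    have "norm (poly (rev_poly n w) ?z) \<le> exp \<eta> * norm (poly (rev_poly m w) ?z)"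
      using w n j by (auto simp: growth_event_def not_less)
    also have "\<dots> \<le> exp \<eta> * circle_sup_norm (poly (rev_poly m w))"
      by (intro mult_left_mono norm_le_circle_sup_norm) auto
    finally show "norm (poly (rev_poly n w) ?z) \<le> exp \<eta> * circle_sup_norm (poly (rev_poly m w))" .
  qed fact
  then show ?thesis
    by (simp add: exp_add mult_ac)
qed

end

section \<open>Summation over the blocks\<close>

text \<open>
  Apart from constants, the first condensation replaces the terms by \<open>sqrt (R\<^bsub>2^n\<^esub> / n)\<close>,
  and the second one turns this into \<open>2\<^sup>k sqrt (R\<^bsub>N_k\<^esub> / 2\<^sup>k)\<close> with \<open>N\<^sub>k = 2\<^bsup>2^k\<^esup>\<close>.
\<close>

lemma condensed_tail_summable:
  fixes R :: "nat \<Rightarrow> real"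
  assumes dec: "\<And>n. R (Suc n) \<le> R n" and nonneg: "\<And>n. 0 \<le> R n"
    and sum: "summable (\<lambda>n. sqrt (R (n + 2)) / (real (n + 2) * sqrt (ln (real (n + 2)))))"
  shows "summable (\<lambda>k. sqrt (2 ^ k * R (2 ^ 2 ^ k)))"
proof -
  have R: "R n \<le> R m" if "m \<le> n" for m n
    using dec that by (rule lift_Suc_antimono_le)
  \<comment> \<open>Condensation needs a sequence decreasing from index 1 on, but the logarithm vanishes there.\<close>
  define f where "f n = sqrt (R (max n 2)) / (real (max n 2) * sqrt (ln (real (max n 2))))" for n
  have f_nonneg: "0 \<le> f n" for n
    using nonneg by (auto simp: f_def intro!: divide_nonneg_nonneg mult_nonneg_nonneg)
  have "summable f"
    by (subst summable_iff_shift [of f 2, symmetric]) (use sum in \<open>simp add: f_def\<close>)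
  moreover have "f (Suc n) \<le> f n" for n
    unfolding f_def using nonneg
    by (intro frac_le mult_mono real_sqrt_le_mono R) (auto intro!: mult_pos_pos)
  ultimately have sum1: "summable (\<lambda>n. 2 ^ n * f (2 ^ n))"
    by (subst (asm) condensation_test) (auto simp: f_nonneg)
  have g: "2 ^ n * f (2 ^ n) = sqrt (R (2 ^ n)) / sqrt (real n * ln 2)" if "0 < n" for n
  proof -
    have "max (2 ^ n) 2 = (2 ^ n :: nat)"
      using that by (cases n) auto
    then show ?thesis
      by (simp add: f_def ln_realpow)
  qed
  have "summable (\<lambda>k. 2 ^ k * (2 ^ 2 ^ k * f (2 ^ 2 ^ k)))"
  proof (subst condensation_test [symmetric])
    fix n :: nat assume "0 < n"
    then show "2 ^ Suc n * f (2 ^ Suc n) \<le> 2 ^ n * f (2 ^ n)"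
      unfolding g [OF \<open>0 < n\<close>] g [OF zero_less_Suc] using nonneg
      by (intro frac_le real_sqrt_le_mono R mult_right_mono) (auto intro!: mult_pos_pos)
  qed (use f_nonneg sum1 in auto)
  also have "(\<lambda>k. 2 ^ k * (2 ^ 2 ^ k * f (2 ^ 2 ^ k))) = (\<lambda>k. sqrt (2 ^ k * R (2 ^ 2 ^ k)) / sqrt (ln 2))"
  proof
    fix k :: nat
    have "2 ^ k * (2 ^ 2 ^ k * f (2 ^ 2 ^ k))
        = (2 ^ k / sqrt (2 ^ k)) * (sqrt (R (2 ^ 2 ^ k)) / sqrt (ln 2))"
      using g [of "2 ^ k"] by (simp add: real_sqrt_mult)
    also have "2 ^ k / sqrt (2 ^ k) = sqrt (2 ^ k :: real)"
      by (rule real_div_sqrt) simp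
    finally show "2 ^ k * (2 ^ 2 ^ k * f (2 ^ 2 ^ k)) = sqrt (2 ^ k * R (2 ^ 2 ^ k)) / sqrt (ln 2)"
      by (simp add: real_sqrt_mult)
  qed
  finally show ?thesis
    by (simp add: summable_divide_iff)
qed

text \<open>
  From the first block on which the growth bound holds permanently, every value is at most the product
  of the growth factors passed so far times the value at the start of that block.
\<close>

lemma bounded_if_summable_block_growth:
  fixes S :: "nat \<Rightarrow> real" and N :: "nat \<Rightarrow> nat"
  assumes N: "strict_mono N" and S: "\<And>n. 0 \<le> S n"
    and \<mu>: "summable \<mu>" "\<And>k. 0 \<le> \<mu> k"
    and growth: "\<forall>\<^sub>F k in sequentially. \<forall>n\<in>{N k<..N (Suc k)}. S n \<le> exp (\<mu> k) * S (N k)"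
  shows "\<exists>C. \<forall>n. S n \<le> C"
proof -
  obtain K where K: "\<And>k n. K \<le> k \<Longrightarrow> n \<in> {N k<..N (Suc k)} \<Longrightarrow> S n \<le> exp (\<mu> k) * S (N k)"
    using growth unfolding eventually_sequentially by blast
  have block: "\<forall>n\<in>{N K..N k}. S n \<le> exp (\<Sum>i\<in>{K..<k}. \<mu> i) * S (N K)" if "K \<le> k" for k
    using that
  proof (induction k rule: dec_induct)
    case (step k)
    show ?case
    proof
      fix n assume n: "n \<in> {N K..N (Suc k)}"
      define e where "e = exp (\<Sum>i\<in>{K..<k}. \<mu> i) * S (N K)"
      have e: "exp (\<mu> k) * e = exp (\<Sum>i\<in>{K..<Suc k}. \<mu> i) * S (N K)"
        using step.hyps by (simp add: e_def exp_add)
      have "0 \<le> e" using S by (simp add: e_def)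
      show "S n \<le> exp (\<Sum>i\<in>{K..<Suc k}. \<mu> i) * S (N K)"
      proof (cases "n \<le> N k")
        case True
        then have "S n \<le> e"
          using step.IH n by (auto simp: e_def)
        also have "\<dots> \<le> exp (\<mu> k) * e"
          using \<open>0 \<le> e\<close> \<mu>(2) [of k] by (simp add: mult_le_cancel_right1)
        finally show ?thesis by (simp add: e)
      next
        case False
        have "N K \<le> N k"
          using N step.hyps by (simp add: strict_mono_less_eq)
        then have "S (N k) \<le> e"
          using step.IH by (auto simp: e_def)
        then have "exp (\<mu> k) * S (N k) \<le> exp (\<mu> k) * e"
          by (intro mult_left_mono) auto
        moreover have "S n \<le> exp (\<mu> k) * S (N k)"
          using K step.hyps n False by auto
        ultimately show ?thesis by (simp add: e)
      qed
    qed
  qed auto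
  define C where "C = Max (S ` {..N K}) + exp (suminf \<mu>) * S (N K)"
  have "S n \<le> C" for n
  proof (cases "n \<le> N K")
    case True
    then have "S n \<le> Max (S ` {..N K})"
      by (intro Max_ge) auto
    then show ?thesis
      using S by (simp add: C_def add_increasing2)
  next
    case False
    have "n \<le> N (max K n)"
      using strict_mono_imp_increasing [OF N] strict_mono_less_eq [OF N] by (meson le_trans max.cobounded2)
    with False have "S n \<le> exp (\<Sum>i\<in>{K..<max K n}. \<mu> i) * S (N K)"
      using block [of "max K n"] by auto
    also have "\<dots> \<le> exp (suminf \<mu>) * S (N K)"
      using \<mu> S by (intro mult_right_mono) (auto intro!: sum_le_suminf)
    also have "\<dots> \<le> C"
      using S [of 0] by (auto simp: C_def Max_ge_iff)
    finally show ?thesis .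
  qed
  then show ?thesis by blast
qed

text \<open>
  Here \<open>L = 2\<^sup>k\<close> is comparable to \<open>log N\<close>, and \<open>9y\<close> is the allowed logarithmic growth. The Gaussian
  optimum \<open>q = 9y/r\<close> is unbounded as \<open>r\<close> tends to 0; the order \<open>L/y\<close>, rounded up, is optimal up to a
  constant when \<open>r = y\<^sup>2/L\<close> and serves all smaller \<open>r\<close> as well. The factor 9 is chosen so that
  the exponent beats the number of events in the union bound, which is at most \<open>exp (12 L)\<close>.
\<close>

lemma optimised_exponent:
  fixes L r y :: real
  assumes "0 < y" "y \<le> 1" "1 \<le> L" "L * r \<le> y ^ 2"
  defines "q \<equiv> real (nat \<lceil>L / y\<rceil>)"
  shows "q ^ 2 * r - 2 * q * (9 * y) \<le> - 14 * L"
proof -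
  have "1 \<le> L / y"
    using assms by (simp add: field_simps)
  moreover have "x \<le> real (nat \<lceil>x\<rceil>)" "real (nat \<lceil>x\<rceil>) \<le> 2 * x" if "1 \<le> x" for x :: real
    using that by linarith+
  ultimately have q: "L / y \<le> q" "q \<le> 2 * (L / y)"
    unfolding q_def by blast+
  have q_nonneg: "0 \<le> q"
    by (simp add: q_def)
  have "r \<le> y ^ 2 / L"
    using assms by (simp add: field_simps)
  then have "q ^ 2 * r \<le> q ^ 2 * (y ^ 2 / L)"
    by (intro mult_left_mono) auto
  also have "\<dots> \<le> (2 * (L / y)) ^ 2 * (y ^ 2 / L)"
    using q assms(1,3) q_nonneg by (intro mult_right_mono power_mono) auto
  also have "\<dots> = 4 * L"
    using assms by (simp add: field_simps power2_eq_square)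
  finally have "q ^ 2 * r \<le> 4 * L" .
  moreover have "L \<le> q * y"
    using q(1) assms(1) by (simp add: pos_divide_le_eq)
  ultimately show ?thesis by simp
qed

theorem theorem1p1:
  fixes M :: "'w measure"
    and \<omega> :: "nat \<Rightarrow> 'w \<Rightarrow> complex"
    and a R :: "nat \<Rightarrow> real"
  assumes "prob_space M"
    and "\<And>n. a n \<in> {-1<..<1}"
    and "\<And>k. (\<lambda>n. (a (n + k))\<^sup>2) sums R k"
    and "summable (\<lambda>n. sqrt (R (n + 2)) / (real (n + 2) * sqrt (ln (real (n + 2)))))"
    and "prob_space.indep_vars M (\<lambda>_. borel) \<omega> UNIV"
    and "\<And>n. AE w in M. norm (\<omega> n w) \<le> 1"
    and "\<And>n. rotationally_symmetric M (\<omega> n)"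
  shows "AE w in M. \<exists>C::real. \<forall>n.
           circle_sup_norm (poly (opuc_rev (\<lambda>k. of_real (a k) * \<omega> k w) n)) \<le> C"
proof -
  interpret prob_space M by fact
  interpret random_verblunsky M \<omega> a
    using assms by unfold_locales auto
  have R_nonneg: "0 \<le> R k" for k
    by (rule sums_le [OF _ sums_zero assms(3)]) simp
  have tail: "(\<Sum>j\<in>{m..<n}. (a j)\<^sup>2) \<le> R m" for m n
  proof -
    have "(\<Sum>j\<in>{m..<n}. (a j)\<^sup>2) = (\<Sum>j<n - m. (a (j + m))\<^sup>2)"
      by (rule sum.reindex_bij_witness [of _ "\<lambda>j. j + m" "\<lambda>j. j - m"]) auto
    also have "\<dots> \<le> R m"
      using assms(3) [of m] by (metis sum_le_suminf finite_lessThan sums_iff zero_le_power2)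
    finally show ?thesis .
  qed
  have R_dec: "R (Suc k) \<le> R k" for k
  proof -
    have "(\<lambda>n. (a (Suc n + k))\<^sup>2) sums R (Suc k)"
      using assms(3) [of "Suc k"] by simp
    then have "(\<lambda>n. (a (n + k))\<^sup>2) sums (R (Suc k) + (a (0 + k))\<^sup>2)"
      by (rule sums_Suc)
    then have "R k = R (Suc k) + (a k)\<^sup>2"
      using assms(3) [of k] sums_unique2 by fastforce
    then show ?thesis by simp
  qed
  define N :: "nat \<Rightarrow> nat" where "N k = 2 ^ 2 ^ k" for k
  \<comment> \<open>The geometric term keeps \<open>y k\<close> positive when the tail sum vanishes.\<close>
  define y where "y k = sqrt (2 ^ k * R (N k)) + (1 / 2) ^ k" for k
  define q where "q k = nat \<lceil>2 ^ k / y k\<rceil>" for k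
  define bad where "bad k = growth_event (N k) (N (Suc k)) (9 * y k)" for k
  have N: "strict_mono N"
    by (rule strict_monoI) (simp add: N_def)
  have N4: "4 \<le> N (Suc k)" for k
    using strict_mono_less_eq [OF N, of 1 "Suc k"] by (simp add: N_def)
  have y_pos: "0 < y k" for k
    using R_nonneg by (auto simp: y_def intro!: add_nonneg_pos)
  have y_sum: "summable y"
    unfolding y_def N_def
    using condensed_tail_summable [OF R_dec R_nonneg assms(4)]
    by (intro summable_add) (auto intro!: summable_geometric)
  have "\<forall>\<^sub>F k in sequentially. y k < 1"
    using summable_LIMSEQ_zero [OF y_sum] by (rule order_tendstoD) simp
  then have prob_bad: "\<forall>\<^sub>F k in sequentially. norm (prob (bad k)) \<le> exp (- 1) ^ k"
  proof eventually_elim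
    case (elim k)
    have "2 ^ k * R (N k) = (sqrt (2 ^ k * R (N k)))\<^sup>2"
      using R_nonneg by simp
    also have "\<dots> \<le> (y k)\<^sup>2"
      using R_nonneg by (intro power_mono) (auto simp: y_def)
    finally have exponent: "real (q k) ^ 2 * R (N k) - 2 * real (q k) * (9 * y k) \<le> - 14 * 2 ^ k"
      unfolding q_def using elim y_pos [of k] by (intro optimised_exponent) auto
    \<comment> \<open>The union bound costs a factor \<open>exp (12 * 2 ^ k)\<close>, less than the exponent gains.\<close>
    have "real (N (Suc k)) ^ 6 = 2 ^ (12 * 2 ^ k)"
      by (simp add: N_def power_mult [symmetric] mult.commute)
    also have "\<dots> \<le> exp 1 ^ (12 * 2 ^ k)"
      using exp_ge_add_one_self [of 1] by (intro power_mono) auto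
    also have "\<dots> = exp (12 * 2 ^ k)"
      by (simp add: exp_of_nat_mult [symmetric])
    finally have count: "real (N (Suc k)) ^ 6 \<le> exp (12 * 2 ^ k)" .
    have "prob (bad k) \<le> real (N (Suc k)) ^ 6
        * exp (real (q k) ^ 2 * R (N k) - 2 * real (q k) * (9 * y k))"
      unfolding bad_def by (intro prob_growth_event_le tail)
    also have "\<dots> \<le> exp (12 * 2 ^ k) * exp (- 14 * 2 ^ k)"
      using count exponent by (intro mult_mono) auto
    also have "\<dots> = exp (- (2 * 2 ^ k))"
      by (simp add: exp_add [symmetric])
    also have "\<dots> \<le> exp (- real k)"
    proof -
      have "real k < 2 ^ k"
        by (rule of_nat_less_two_power)
      moreover have "(0 :: real) \<le> 2 ^ k"
        by simp
      ultimately have "real k \<le> 2 * 2 ^ k"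
        by linarith
      then show ?thesis by simp
    qed
    also have "\<dots> = exp (- 1) ^ k"
      by (simp add: exp_of_nat_mult [symmetric])
    finally show ?case by simp
  qed
  have "summable (\<lambda>k. prob (bad k))"
    by (rule summable_comparison_test_ev [OF prob_bad]) (simp add: summable_geometric)
  then have "AE w in M. \<forall>\<^sub>F k in sequentially. w \<in> space M - bad k"
    by (intro borel_cantelli_AE1) (auto simp: bad_def less_top [symmetric])
  then show ?thesis
  proof eventually_elim
    case (elim w)
    define \<mu> where "\<mu> k = 9 * y k + (1 / 2) ^ k" for k
    have "\<exists>C. \<forall>n. circle_sup_norm (poly (rev_poly n w)) \<le> C"
    proof (rule bounded_if_summable_block_growth [OF N circle_sup_norm_nonneg])
      show "summable \<mu>"
        unfolding \<mu>_def by (intro summable_add summable_mult y_sum summable_geometric) simp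
      show "0 \<le> \<mu> k" for k
        using y_pos [of k] by (simp add: \<mu>_def)
      show "\<forall>\<^sub>F k in sequentially. \<forall>n\<in>{N k<..N (Suc k)}.
          circle_sup_norm (poly (rev_poly n w)) \<le> exp (\<mu> k) * circle_sup_norm (poly (rev_poly (N k) w))"
        using elim
      proof eventually_elim
        case (elim k)
        have "2 ^ k \<le> real (N (Suc k))"
          unfolding N_def using less_exp [of "Suc k"] by (simp add: less_imp_le)
        then have "1 / real (N (Suc k)) \<le> (1 / 2) ^ k"
          by (simp add: power_one_over frac_le)
        then have "exp (9 * y k + 1 / real (N (Suc k))) \<le> exp (\<mu> k)"
          by (simp add: \<mu>_def)
        then show ?case
          using circle_sup_norm_outside_growth_event [OF elim [unfolded bad_def] _ N4]
          by (meson circle_sup_norm_nonneg mult_right_mono order_trans)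
      qed
    qed
    then show ?case
      by (simp add: rev_poly_def)
  qed
qed

end
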